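(* Let $a,b$ be integers with $1<a\le b$. For all $f,g\in\mathcal A$, \begin{align*} D_q^a[f]\,D_q^b[g] &= \sum_{j=0}^{a-1}\sum_{i=1}^{b-j}(-1)^{j}\binom{a+b-1-i-j}{j,\;a-1-j,\;b-i-j}D_q^j\big[f\,D_q^i[g]\big]\\ &\quad+\sum_{j=1}^{a}\sum_{i=1}^{b-j}(-1)^{j}\binom{a+b-1-i-j}{j-1,\;a-j,\;b-i-j}D_q^j\big[f\,D_q^i[g]\big]\\ &\quad+\sum_{j=0}^{b-1}\sum_{i=1}^{a-j}(-1)^{j}\binom{a+b-1-i-j}{j,\;b-1-j,\;a-i-j}D_q^j\big[D_q^i[f]\,g\big]\\ &\quad+\sum_{j=1}^{b}\sum_{i=1}^{a-j}(-1)^{j}\binom{a+b-1-i-j}{j-1,\;b-j,\;a-i-j}D_q^j\big[D_q^i[f]\,g\big]\\ &\quad+\sum_{j=1}^{a}(-1)^{j}\binom{a+b-1-j}{j-1,\;a-j,\;b-j}D_q^j[fg]. \end{align*}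
   Context: $\mathcal A=t\,\mathbb Q[[t,q]]$ is the (non-unital, commutative) algebra of formal power series in $t,q$ with strictly positive valuation in $t$. The $q$-dilation operator is $E_q[f](t)=f(qt)$ and the $q$-difference operator is the $\mathbb Q[[q]]$-linear map $D_q=I-E_q:\mathcal A\to\mathcal A$, i.e. $D_q[f](t)=f(t)-f(qt)$. $D_q^n$ denotes the $n$-fold composition, $D_q^0=I$. For non-negative integers $x,y,z$ with $x+y+z=N$, $\binom{N}{x,y,z}=\frac{N!}{x!\,y!\,z!}$ is the trinomial coefficient. Empty sums (upper limit smaller than lower limit) are $0$. *)

theory Defs
  imports "HOL-Computational_Algebra.Formal_Power_Series"
begin

text \<open>
  \<open>\<rat>[[t, q]]\<close> is represented as \<open>(\<rat>[[q]])[[t]]\<close>: in \<^typ>\<open>rat fps fps\<close> the outer series variable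
  is \<open>t\<close> and the inner one is \<open>q\<close>.
\<close>

definition var_t :: "rat fps fps" where
  "var_t = fps_X"

definition var_q :: "rat fps fps" where
  "var_q = fps_const fps_X"

text \<open>The ideal \<open>t \<rat>[[t, q]]\<close>, as a subset of the ambient unital ring.\<close>

definition pos_val :: "rat fps fps set" where
  "pos_val = {var_t * h | h. True}"

definition q_dil :: "rat fps fps \<Rightarrow> rat fps fps" where
  "q_dil f = fps_compose f (var_q * var_t)"

definition q_diff :: "rat fps fps \<Rightarrow> rat fps fps" where
  "q_diff f = f - q_dil f"

text \<open>
  Only meaningful for \<open>x + y + z = N\<close>; the division is then exact, see \<open>trinomial_exact\<close> below.
\<close>

definition trinomial :: "nat \<Rightarrow> nat \<Rightarrow> nat \<Rightarrow> nat \<Rightarrow> nat" where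
  "trinomial N x y z = fact N div (fact x * fact y * fact z)"

lemma trinomial_exact:
  assumes "x + y + z = N"
  shows "trinomial N x y z * (fact x * fact y * fact z) = fact N"
proof -
  have "fact x * fact y * fact z dvd (fact (x + y) * fact z :: nat)"
    by (intro mult_dvd_mono fact_fact_dvd_fact dvd_refl)
  also have "\<dots> dvd (fact (x + y + z) :: nat)"
    by (rule fact_fact_dvd_fact)
  finally show ?thesis
    using assms by (simp add: trinomial_def)
qed

lemma pos_val_iff: "f \<in> pos_val \<longleftrightarrow> fps_nth f 0 = 0"
proof
  assume "f \<in> pos_val"
  then show "fps_nth f 0 = 0"
    by (auto simp: pos_val_def var_t_def)
next
  assume "fps_nth f 0 = 0"
  then have "f = var_t * fps_shift 1 f"
    by (intro fps_ext) (auto simp: var_t_def)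
  then show "f \<in> pos_val"
    unfolding pos_val_def by blast
qed

lemma q_dil_nth: "fps_nth (q_dil f) n = fps_X ^ n * fps_nth f n"
proof -
  have "fps_nth ((var_q * var_t) ^ i) n = (if n = i then fps_X ^ i else 0)" for i
    by (simp add: var_q_def var_t_def power_mult_distrib fps_const_power fps_X_power_nth)
  then show ?thesis
    by (simp add: q_dil_def fps_compose_nth mult.commute mult_delta_right)
qed

lemma q_diff_pos_val: "f \<in> pos_val \<Longrightarrow> q_diff f \<in> pos_val"
  by (simp add: pos_val_iff q_diff_def q_dil_nth)

end

theory Submission
  imports Defs
begin

text \<open>
  On the coefficient of \<open>t\<^sup>n\<close> the operator \<open>D\<^sub>q\<close> acts as multiplication by \<open>1 - q\<^sup>n\<close>. Hence the
  pair \<open>f\<^sub>k t\<^sup>k\<close>, \<open>g\<^sub>l t\<^sup>l\<close> with \<open>k + l = n\<close> contributes, on both sides, a multiple of a polynomial in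
  \<open>x = 1 - q\<^sup>k\<close>, \<open>y = 1 - q\<^sup>l\<close> and \<open>z = 1 - q\<^sup>n\<close>, which are related by \<open>x y = x + y + w\<close> where \<open>w = - z\<close>.
  The monomials \<open>x\<^sup>a y\<^sup>b\<close> therefore satisfy the Delannoy recurrence
  \<open>P(a + 1, b + 1) = P(a, b + 1) + P(a + 1, b) + w P(a, b)\<close>, and so do the right-hand sides, because
  the trinomial coefficients count Delannoy paths by their number of diagonal steps.
\<close>

section \<open>Delannoy paths counted by diagonal steps\<close>

text \<open>The number of Delannoy paths to \<open>(a, b)\<close> with \<open>j\<close> diagonal
  steps: choose the steps that raise the first coordinate, then the diagonal ones among them. The
  product is 0 once \<open>j\<close> exceeds \<open>a\<close> or \<open>b\<close>, so summation
  ranges can be enlarged freely.\<close>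

definition delannoy_coeff :: "nat \<Rightarrow> nat \<Rightarrow> nat \<Rightarrow> nat" where
  "delannoy_coeff a b j = (a + b - j choose a) * (a choose j)"

lemma trinomial_eq_delannoy_coeff:
  assumes "x + y + z = N"
  shows "trinomial N x y z = delannoy_coeff (x + y) (x + z) x"
proof -
  have 1: "x + y + (x + z) - x = x + y + z"
    by simp
  have "fact (x + y) * fact z * (x + y + z choose (x + y)) = (fact (x + y + z) :: nat)"
    using binomial_fact_lemma[of "x + y" "x + y + z"] by simp
  moreover have "fact x * fact y * (x + y choose x) = (fact (x + y) :: nat)"
    using binomial_fact_lemma[of x "x + y"] by simp
  ultimately have "delannoy_coeff (x + y) (x + z) x * (fact x * fact y * fact z) = fact (x + y + z)"
    unfolding delannoy_coeff_def 1 by (metis mult.assoc mult.commute)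
  also have "\<dots> = trinomial N x y z * (fact x * fact y * fact z)"
    using trinomial_exact[OF assms] assms by simp
  finally show ?thesis
    by simp
qed

lemma delannoy_coeff_eq_0:
  assumes "a < j \<or> b < j"
  shows "delannoy_coeff a b j = 0"
  using assms by (cases "a < j") (auto simp: delannoy_coeff_def)

lemma delannoy_coeff_0 [simp]: "delannoy_coeff a b 0 = (a + b choose a)"
  by (simp add: delannoy_coeff_def)

text \<open>Pascal's rule for both binomials, or a split by the last step of the path. For
  \<open>j\<close> at most \<open>a + b\<close> no subtraction truncates; otherwise all four terms
  vanish.\<close>

lemma delannoy_coeff_Suc:
  "delannoy_coeff (Suc a) (Suc b) (Suc j) =
     delannoy_coeff a (Suc b) (Suc j) + delannoy_coeff (Suc a) b (Suc j) + delannoy_coeff a b j"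
proof (cases "j \<le> a + b")
  case True
  then obtain N where "a + b = j + N"
    using le_Suc_ex by blast
  then have "Suc a + Suc b - Suc j = Suc N" "a + Suc b - Suc j = N" "Suc a + b - Suc j = N"
    "a + b - j = N"
    by auto
  then show ?thesis
    unfolding delannoy_coeff_def by (simp add: algebra_simps)
next
  case False
  then show ?thesis
    by (simp add: delannoy_coeff_eq_0)
qed

section \<open>Weighted path polynomials and the expansion of monomials\<close>

definition delannoy :: "'a::comm_ring_1 \<Rightarrow> nat \<Rightarrow> nat \<Rightarrow> 'a" where
  "delannoy w a b = (\<Sum>j\<le>a. of_nat (delannoy_coeff a b j) * w ^ j)"

lemma delannoy_0_left [simp]: "delannoy w 0 b = 1"
  by (simp add: delannoy_def)

lemma delannoy_0_right [simp]: "delannoy w a 0 = 1"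
proof -
  have "delannoy w a 0 = (\<Sum>j\<in>{0}. of_nat (delannoy_coeff a 0 j) * w ^ j)"
    unfolding delannoy_def
    by (rule sum.mono_neutral_right) (auto simp: delannoy_coeff_eq_0)
  then show ?thesis
    by simp
qed

lemma delannoy_Suc:
  "delannoy w (Suc a) (Suc b) =
     delannoy w a (Suc b) + delannoy w (Suc a) b + w * delannoy w a b"
proof -
  \<comment> \<open>The added term \<open>j = Suc a\<close> is zero; all sums can now be compared
    after splitting off \<open>j = 0\<close>.\<close>
  have "delannoy w a (Suc b) = (\<Sum>j\<le>Suc a. of_nat (delannoy_coeff a (Suc b) j) * w ^ j)"
    by (simp add: delannoy_def delannoy_coeff_eq_0)
  then show ?thesis
    unfolding delannoy_def
    by (simp add: sum.atMost_Suc_shift delannoy_coeff_Suc sum.distrib sum_distrib_left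
        algebra_simps del: sum.atMost_Suc)
qed

text \<open>With \<open>w = - z\<close>, the first two double sums of the scalar identity are
  \<open>delannoy_sum w y (a - 1) b\<close> and
  \<open>w * delannoy_sum w y (a - 1) (b - 1)\<close>.\<close>

definition delannoy_sum :: "'a::comm_ring_1 \<Rightarrow> 'a \<Rightarrow> nat \<Rightarrow> nat \<Rightarrow> 'a" where
  "delannoy_sum w y n b = (\<Sum>i = 1..b. y ^ i * delannoy w n (b - i))"

lemma delannoy_sum_0_right [simp]: "delannoy_sum w y n 0 = 0"
  by (simp add: delannoy_sum_def)

lemma delannoy_sum_0_left_Suc: "delannoy_sum w y 0 (Suc b) = delannoy_sum w y 0 b + y ^ Suc b"
  by (simp add: delannoy_sum_def)

lemma delannoy_sum_1 [simp]: "delannoy_sum w y n (Suc 0) = y"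
  by (simp add: delannoy_sum_def)

text \<open>The recurrence of \<open>delannoy\<close> applies to each \<open>i\<close> up to
  \<open>b\<close>; the remaining term \<open>y ^ Suc b\<close> agrees on both sides because
  \<open>delannoy w n 0\<close> is 1 for every \<open>n\<close>.\<close>

lemma delannoy_sum_Suc:
  "delannoy_sum w y (Suc n) (Suc b) =
     delannoy_sum w y n (Suc b) + delannoy_sum w y (Suc n) b + w * delannoy_sum w y n b"
  by (simp add: delannoy_sum_def Suc_diff_le delannoy_Suc sum.distrib sum_distrib_left
      algebra_simps)

lemma power_mult_power_delannoy_0:
  fixes x y w :: "'a::comm_ring_1"
  assumes "x * y = x + y + w"
  shows "x * y ^ Suc b = delannoy_sum w y 0 (Suc b) + w * delannoy_sum w y 0 b + x + w"
proof (induction b)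
  case 0
  show ?case
    using assms by (simp add: algebra_simps)
next
  case (Suc b)
  have "x * y ^ Suc (Suc b) = (x * y) * y ^ Suc b"
    by (simp add: algebra_simps)
  also have "\<dots> = x * y ^ Suc b + y ^ Suc (Suc b) + w * y ^ Suc b"
    unfolding assms by (simp add: algebra_simps)
  finally show ?case
    unfolding Suc by (simp add: delannoy_sum_0_left_Suc algebra_simps)
qed

text \<open>Both sides satisfy the Delannoy recurrence, so a double induction reduces the claim to
  exponent 1 in \<open>x\<close> or in \<open>y\<close>. These two edges are the preceding lemma and
  its mirror image.\<close>

lemma power_mult_power_delannoy:
  fixes x y w :: "'a::comm_ring_1"
  assumes "x * y = x + y + w"
  shows "x ^ Suc a * y ^ Suc b =
      delannoy_sum w y a (Suc b) + w * delannoy_sum w y a b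
    + (delannoy_sum w x b (Suc a) + w * delannoy_sum w x b a) + w * delannoy w a b"
proof (induction a arbitrary: b)
  case 0
  show ?case
    using power_mult_power_delannoy_0[OF assms, of b] by simp
next
  case (Suc a)
  \<comment> \<open>The outer hypothesis, valid for all \<open>b\<close>, is saved before the inner
    induction reuses its name.\<close>
  note IH = Suc.IH
  show ?case
  proof (induction b)
    case 0
    have "y * x = y + x + w"
      using assms by (simp add: algebra_simps)
    from power_mult_power_delannoy_0[OF this, of "Suc a"] show ?case
      by (simp add: algebra_simps)
  next
    case (Suc b)
    have "x ^ Suc (Suc a) * y ^ Suc (Suc b) = (x * y) * (x ^ Suc a * y ^ Suc b)"
      by (simp add: algebra_simps)
    also have "\<dots> = x ^ Suc a * y ^ Suc (Suc b) + x ^ Suc (Suc a) * y ^ Suc b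
        + w * (x ^ Suc a * y ^ Suc b)"
      unfolding assms by (simp add: algebra_simps)
    also have "\<dots> = delannoy_sum w y (Suc a) (Suc (Suc b)) + w * delannoy_sum w y (Suc a) (Suc b)
      + (delannoy_sum w x (Suc b) (Suc (Suc a)) + w * delannoy_sum w x (Suc b) (Suc a))
      + w * delannoy w (Suc a) (Suc b)"
      unfolding Suc.IH IH
      unfolding delannoy_sum_Suc[of w y a "Suc b"] delannoy_sum_Suc[of w y a b]
        delannoy_sum_Suc[of w x b "Suc a"] delannoy_sum_Suc[of w x b a] delannoy_Suc[of w a b]
      by (simp only: algebra_simps)
    finally show ?case .
  qed
qed

section \<open>Translation to trinomial coefficients\<close>

lemma delannoy_sum_eq_trinomial:
  "(\<Sum>j = 0..n. \<Sum>i = 1..b - j.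
      of_nat (trinomial (n + b - i - j) j (n - j) (b - i - j)) * (w ^ j * y ^ i)) =
    delannoy_sum w y n b"
proof -
  have "(\<Sum>i = 1..b - j. of_nat (trinomial (n + b - i - j) j (n - j) (b - i - j)) * (w ^ j * y ^ i))
      = (\<Sum>i = 1..b. of_nat (delannoy_coeff n (b - i) j) * (w ^ j * y ^ i))"
    if "j \<le> n" for j
  \<comment> \<open>Making the range of \<open>i\<close> independent of \<open>j\<close> allows the
    two sums to be exchanged.\<close>
  proof (rule sum.mono_neutral_cong_left)
    show "\<forall>i\<in>{1..b} - {1..b - j}. of_nat (delannoy_coeff n (b - i) j) * (w ^ j * y ^ i) = 0"
    proof
      fix i assume "i \<in> {1..b} - {1..b - j}"
      then have "b - i < j"
        by auto
      then show "of_nat (delannoy_coeff n (b - i) j) * (w ^ j * y ^ i) = 0"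
        by (simp add: delannoy_coeff_eq_0)
    qed
  next
    fix i assume "i \<in> {1..b - j}"
    then have "j + (n - j) + (b - i - j) = n + b - i - j" "j + (n - j) = n" "j + (b - i - j) = b - i"
      using that by auto
    then show "of_nat (trinomial (n + b - i - j) j (n - j) (b - i - j)) * (w ^ j * y ^ i) =
        of_nat (delannoy_coeff n (b - i) j) * (w ^ j * y ^ i)"
      using trinomial_eq_delannoy_coeff by metis
  qed auto
  then have "(\<Sum>j = 0..n. \<Sum>i = 1..b - j.
      of_nat (trinomial (n + b - i - j) j (n - j) (b - i - j)) * (w ^ j * y ^ i)) =
      (\<Sum>j = 0..n. \<Sum>i = 1..b. of_nat (delannoy_coeff n (b - i) j) * (w ^ j * y ^ i))"
    by (intro sum.cong[OF refl]) (simp only: atLeastAtMost_iff)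
  also have "\<dots> = (\<Sum>i = 1..b. \<Sum>j = 0..n. of_nat (delannoy_coeff n (b - i) j) * (w ^ j * y ^ i))"
    by (rule sum.swap)
  also have "\<dots> = delannoy_sum w y n b"
    by (simp add: delannoy_sum_def delannoy_def sum_distrib_left atMost_atLeast0 algebra_simps)
  finally show ?thesis .
qed

lemma delannoy_sum_eq_trinomial_shift:
  "(\<Sum>j = 1..Suc n. \<Sum>i = 1..Suc b - j.
      of_nat (trinomial (Suc n + Suc b - 1 - i - j) (j - 1) (Suc n - j) (Suc b - i - j)) *
      (w ^ j * y ^ i)) =
    w * delannoy_sum w y n b"
proof -
  have "Suc b - i - Suc j = b - i - j" "Suc n + Suc b - 1 - i - Suc j = n + b - i - j" for i j
    by auto
  then show ?thesis
    unfolding delannoy_sum_eq_trinomial[symmetric] One_nat_def sum.shift_bounds_cl_Suc_ivl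
      sum_distrib_left
    by (simp add: algebra_simps)
qed

text \<open>Here no inner range cuts \<open>j\<close> off, so \<open>n \<le> b\<close> is what keeps
  \<open>Suc b - j\<close> from truncating.\<close>

lemma delannoy_eq_trinomial:
  assumes "n \<le> b"
  shows "(\<Sum>j = 1..Suc n.
      of_nat (trinomial (Suc n + Suc b - 1 - j) (j - 1) (Suc n - j) (Suc b - j)) * w ^ j) =
    w * delannoy w n b"
proof -
  have "trinomial (Suc n + Suc b - 1 - Suc j) j (n - j) (b - j) = delannoy_coeff n b j"
    if "j \<le> n" for j
    using trinomial_eq_delannoy_coeff[of j "n - j" "b - j" "n + b - j"] that assms by simp
  then show ?thesis
    unfolding One_nat_def sum.shift_bounds_cl_Suc_ivl delannoy_def sum_distrib_left
      atMost_atLeast0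
    by (intro sum.cong) (auto simp: algebra_simps)
qed

lemma power_mult_power_trinomial:
  fixes x y z :: "'a::comm_ring_1"
  assumes xy: "x * y = x + y - z" and "0 < a" "a \<le> b"
  shows "x ^ a * y ^ b =
      (\<Sum>j = 0..a - 1. \<Sum>i = 1..b - j.
          (-1) ^ j * of_nat (trinomial (a + b - 1 - i - j) j (a - 1 - j) (b - i - j)) *
          (z ^ j * y ^ i))
    + (\<Sum>j = 1..a. \<Sum>i = 1..b - j.
          (-1) ^ j * of_nat (trinomial (a + b - 1 - i - j) (j - 1) (a - j) (b - i - j)) *
          (z ^ j * y ^ i))
    + (\<Sum>j = 0..b - 1. \<Sum>i = 1..a - j.
          (-1) ^ j * of_nat (trinomial (a + b - 1 - i - j) j (b - 1 - j) (a - i - j)) *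
          (z ^ j * x ^ i))
    + (\<Sum>j = 1..b. \<Sum>i = 1..a - j.
          (-1) ^ j * of_nat (trinomial (a + b - 1 - i - j) (j - 1) (b - j) (a - i - j)) *
          (z ^ j * x ^ i))
    + (\<Sum>j = 1..a.
          (-1) ^ j * of_nat (trinomial (a + b - 1 - j) (j - 1) (a - j) (b - j)) * z ^ j)"
proof -
  obtain n m where a: "a = Suc n" and b: "b = Suc m" and "n \<le> m"
    using assms by (metis Suc_le_mono gr0_implies_Suc less_le_trans)
  \<comment> \<open>The signs \<open>(-1) ^ j\<close> are absorbed into the powers of
    \<open>w\<close>.\<close>
  define w where "w = - z"
  have w: "(-1) ^ j * c * (z ^ j * d) = c * (w ^ j * d)" "(-1) ^ j * c * z ^ j = c * w ^ j"
    for j and c d :: 'a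
    by (simp_all add: w_def power_minus[of z] algebra_simps)
  have e: "Suc n + Suc m - 1 = n + Suc m" "Suc m + Suc n - 1 = n + Suc m" "m + Suc n = n + Suc m"
    "Suc n - 1 = n" "Suc m - 1 = m"
    by auto
  note sums = delannoy_sum_eq_trinomial[where n = n and b = "Suc m" and w = w and y = y, unfolded e]
    delannoy_sum_eq_trinomial_shift[where n = n and b = m and w = w and y = y, unfolded e]
    delannoy_sum_eq_trinomial[where n = m and b = "Suc n" and w = w and y = x, unfolded e]
    delannoy_sum_eq_trinomial_shift[where n = m and b = n and w = w and y = x, unfolded e]
    delannoy_eq_trinomial[OF \<open>n \<le> m\<close>, of w, unfolded e]
  have "x * y = x + y + w"
    using xy by (simp add: w_def)
  then show ?thesis
    unfolding a b w e sums by (subst power_mult_power_delannoy[where w = w]) (simp_all only: add.assoc)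
qed

section \<open>From scalars to power series, coefficient by coefficient\<close>

lemma q_diff_power_nth: "fps_nth ((q_diff ^^ k) f) n = (1 - fps_X ^ n) ^ k * fps_nth f n"
  by (induction k) (simp_all add: q_diff_def q_dil_nth algebra_simps)

lemma fps_nth_sign_of_nat_mult:
  fixes F :: "'a::comm_ring_1 fps"
  shows "fps_nth ((-1) ^ j * of_nat c * F) n = (-1) ^ j * of_nat c * fps_nth F n"
proof -
  have "(-1) ^ j * of_nat c = fps_const ((-1) ^ j * of_nat c :: 'a)"
    by (simp flip: fps_of_nat fps_const_mult fps_const_power fps_const_neg)
  then show ?thesis
    by (metis fps_mult_left_const_nth)
qed

theorem theorem2:
  fixes a b :: nat and f g :: "rat fps fps"
  assumes "1 < a" and "a \<le> b"
    and "f \<in> pos_val" and "g \<in> pos_val"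
  shows "(q_diff ^^ a) f * (q_diff ^^ b) g =
      (\<Sum>j = 0..a - 1. \<Sum>i = 1..b - j.
          (-1) ^ j * of_nat (trinomial (a + b - 1 - i - j) j (a - 1 - j) (b - i - j)) *
          (q_diff ^^ j) (f * (q_diff ^^ i) g))
    + (\<Sum>j = 1..a. \<Sum>i = 1..b - j.
          (-1) ^ j * of_nat (trinomial (a + b - 1 - i - j) (j - 1) (a - j) (b - i - j)) *
          (q_diff ^^ j) (f * (q_diff ^^ i) g))
    + (\<Sum>j = 0..b - 1. \<Sum>i = 1..a - j.
          (-1) ^ j * of_nat (trinomial (a + b - 1 - i - j) j (b - 1 - j) (a - i - j)) *
          (q_diff ^^ j) ((q_diff ^^ i) f * g))
    + (\<Sum>j = 1..b. \<Sum>i = 1..a - j.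
          (-1) ^ j * of_nat (trinomial (a + b - 1 - i - j) (j - 1) (b - j) (a - i - j)) *
          (q_diff ^^ j) ((q_diff ^^ i) f * g))
    + (\<Sum>j = 1..a.
          (-1) ^ j * of_nat (trinomial (a + b - 1 - j) (j - 1) (a - j) (b - j)) *
          (q_diff ^^ j) (f * g))"
proof (rule fps_ext, goal_cases)
  case (1 n)
  define c where "c k = fps_nth f k * fps_nth g (n - k)" for k
  define x y where "x k = (1 - fps_X ^ k :: rat fps)" and "y k = (1 - fps_X ^ (n - k) :: rat fps)" for k
  define z :: "rat fps" where "z = 1 - fps_X ^ n"
  \<comment> \<open>This is \<open>q^k q^(n-k) = q^n\<close>, which requires \<open>k\<close> to be
    at most \<open>n\<close>.\<close>
  have xyz: "x k * y k = x k + y k - z" if "k \<in> {0..n}" for k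
    using that by (simp add: x_def y_def z_def algebra_simps flip: power_add)
  have lhs: "fps_nth ((q_diff ^^ a) f * (q_diff ^^ b) g) n = (\<Sum>k = 0..n. c k * (x k ^ a * y k ^ b))"
    by (simp add: fps_mult_nth q_diff_power_nth c_def x_def y_def algebra_simps)
  have right: "fps_nth ((q_diff ^^ j) (f * (q_diff ^^ i) g)) n = (\<Sum>k = 0..n. c k * (z ^ j * y k ^ i))"
    and left: "fps_nth ((q_diff ^^ j) ((q_diff ^^ i) f * g)) n = (\<Sum>k = 0..n. c k * (z ^ j * x k ^ i))"
    and none: "fps_nth ((q_diff ^^ j) (f * g)) n = (\<Sum>k = 0..n. c k * z ^ j)" for i j
    unfolding q_diff_power_nth fps_mult_nth c_def x_def y_def z_def sum_distrib_left
    by (intro sum.cong refl; simp only: mult_ac)+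
  have swap1: "(\<Sum>j\<in>J. d j * (\<Sum>k = 0..n. c k * p k j)) =
      (\<Sum>k = 0..n. c k * (\<Sum>j\<in>J. d j * p k j))"
    for J :: "nat set" and d p
    unfolding sum_distrib_left by (subst sum.swap) (simp add: algebra_simps)
  have swap2: "(\<Sum>j\<in>J. \<Sum>i\<in>I j. d j i * (\<Sum>k = 0..n. c k * p k j i)) =
      (\<Sum>k = 0..n. c k * (\<Sum>j\<in>J. \<Sum>i\<in>I j. d j i * p k j i))"
    for J :: "nat set" and I :: "nat \<Rightarrow> nat set" and d p
    unfolding swap1 sum_distrib_left[of "c _" _ J] by (rule sum.swap)
  have "0 < a"
    using assms by simp
  note expand = power_mult_power_trinomial[OF xyz \<open>0 < a\<close> \<open>a \<le> b\<close>]
  show ?case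
    \<comment> \<open>With the sum over \<open>k\<close> moved outside, both sides carry the same
      weights \<open>c k\<close>, and the scalar identity settles each \<open>k\<close>.\<close>
    unfolding lhs fps_add_nth fps_sum_nth fps_nth_sign_of_nat_mult right left none swap2
    unfolding swap1 sum.distrib[symmetric] distrib_left[symmetric]
    by (intro sum.cong refl arg_cong[where f = "(*) (c _)"] expand)
qed

end
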